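(* The generating function $T_2(x)=\sum_{n\ge 0} t_n^{\#2}x^n$ of the sequence $\{t_n^{\#2}\}_{n\geq0}$ is $$T_2(x)= F(x)-x=\frac{-1-\sqrt{1-8x} + \sqrt{2+2\sqrt{1-8x}+8x} -4x}{4},$$ where $F(x)=\sum_{n\ge1}f_nx^n$.
   Context: A bracketed implication with $n$ distinct variables is a formula obtained from $p_1\to p_2\to\cdots\to p_n$ (variables in this fixed order) by fully inserting brackets ($p_1$ itself for $n=1$); for $n\ge2$ it has the form $\psi\to\phi$ with $\psi$ a bracketing of $p_1\to\cdots\to p_i$ and $\phi$ a bracketing of $p_{i+1}\to\cdots\to p_n$ for some $1\le i\le n-1$. A row is a pair consisting of a bracketed formula and a valuation of $p_1,\dots,p_n$ in $\{0,1\}$ (0 = false, 1 = true). For $n\ge1$, $f_n$ is the number of rows, over all bracketed implications in $n$ variables, in which the formula has value 0. For $n\ge 2$, $t_n^{\#2}$ is the number of rows for which $\psi$ has value 0 and $\phi$ has value 1 (so that $\psi\to\phi$ is true); $t_0^{\#2}=t_1^{\#2}=0$. Square roots denote formal power series with positive constant term. *)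

theory Defs
  imports Complex_Main "HOL-Library.FuncSet" "HOL-Computational_Algebra.Formal_Power_Series"
begin

datatype form = Var nat | Imp form form

fun eval :: "(nat \<Rightarrow> bool) \<Rightarrow> form \<Rightarrow> bool" where
  "eval v (Var i) = v i"
| "eval v (Imp \<psi> \<phi>) = (eval v \<psi> \<longrightarrow> eval v \<phi>)"

text \<open>\<open>bracketing i j \<phi>\<close> states that \<open>\<phi>\<close> is a full bracketing of
  \<open>p\<^sub>i \<rightarrow> \<dots> \<rightarrow> p\<^sub>j\<close>; the bracketed implications with \<open>n\<close> distinct variables
  are the \<open>\<phi>\<close> with \<open>bracketing 1 n \<phi>\<close>.\<close>

inductive bracketing :: "nat \<Rightarrow> nat \<Rightarrow> form \<Rightarrow> bool" where
  single: "bracketing i i (Var i)"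
| split: "bracketing i k \<psi> \<Longrightarrow> bracketing (Suc k) j \<phi> \<Longrightarrow> bracketing i j (Imp \<psi> \<phi>)"

text \<open>A valuation of \<open>p\<^sub>1, \<dots>, p\<^sub>n\<close> is an extensional function on \<open>{1..n}\<close>, so that
  each valuation is counted exactly once.\<close>

definition rows :: "nat \<Rightarrow> (form \<times> (nat \<Rightarrow> bool)) set" where
  "rows n = {\<phi>. bracketing 1 n \<phi>} \<times> ({1..n} \<rightarrow>\<^sub>E (UNIV :: bool set))"

definition f :: "nat \<Rightarrow> nat" where
  "f n = card {(\<phi>, v) \<in> rows n. \<not> eval v \<phi>}"

definition t2 :: "nat \<Rightarrow> nat" where
  "t2 n = (if n < 2 then 0 else
     card {(\<chi>, v) \<in> rows n. \<exists>\<psi> \<phi>. \<chi> = Imp \<psi> \<phi> \<and> \<not> eval v \<psi> \<and> eval v \<phi>})"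

definition F :: "real fps" where
  "F = Abs_fps (\<lambda>n. if n = 0 then 0 else real (f n))"

definition T2 :: "real fps" where
  "T2 = Abs_fps (\<lambda>n. real (t2 n))"

text \<open>For a series with positive constant term, this is the square root with positive
  constant term, see \<open>fps_sqrt_iff\<close> below.\<close>

definition fps_sqrt :: "real fps \<Rightarrow> real fps" where
  "fps_sqrt a = fps_radical root 2 a"

lemma fps_sqrt_iff:
  assumes "fps_nth a 0 > 0"
  shows "b = fps_sqrt a \<longleftrightarrow> b ^ 2 = a \<and> fps_nth b 0 > 0"
proof -
  have r: "root (Suc 1) (fps_nth a 0) ^ Suc 1 = fps_nth a 0"
    using assms by (intro real_root_pow_pos2) auto
  have a: "fps_nth a 0 \<noteq> 0" using assms by simp
  show ?thesis
  proof
    assume b: "b = fps_sqrt a"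
    have "b ^ 2 = a"
      using power_radical[where r = root and k = 1, OF a] r
      unfolding b fps_sqrt_def Suc_1 by blast
    moreover have "fps_nth b 0 > 0"
      using assms by (simp add: b fps_sqrt_def)
    ultimately show "b ^ 2 = a \<and> fps_nth b 0 > 0" ..
  next
    assume b: "b ^ 2 = a \<and> fps_nth b 0 > 0"
    then have "fps_nth a 0 = fps_nth b 0 ^ 2"
      by (metis fps_nth_power_0)
    with b have "root (Suc 1) (fps_nth a 0) = fps_nth b 0"
      by (simp add: real_root_power_cancel numeral_2_eq_2[symmetric])
    from radical_unique[where r = root and k = 1, OF r this a] b
    show "b = fps_sqrt a"
      unfolding fps_sqrt_def Suc_1 by blast
  qed
qed

lemma bracketing_le: "bracketing i j \<phi> \<Longrightarrow> i \<le> j"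
  by (induction rule: bracketing.induct) auto

lemma finite_bracketing: "finite {\<phi>. bracketing i j \<phi>}"
proof (induction "j - i" arbitrary: i j rule: less_induct)
  case less
  have sub: "{\<phi>. bracketing i j \<phi>} \<subseteq> {Var i} \<union>
      (\<Union>k\<in>{i..<j}. (\<lambda>(\<psi>, \<phi>). Imp \<psi> \<phi>) ` ({\<psi>. bracketing i k \<psi>} \<times> {\<phi>. bracketing (Suc k) j \<phi>}))"
    by (force elim: bracketing.cases dest: bracketing_le)
  show ?case
  proof (rule finite_subset[OF sub], intro finite_UnI finite_UN_I finite_imageI finite_cartesian_product)
    fix k assume "k \<in> {i..<j}"
    then show "finite {\<psi>. bracketing i k \<psi>}" "finite {\<phi>. bracketing (Suc k) j \<phi>}"
      by (auto intro!: less)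
  qed auto
qed

lemma finite_rows: "finite (rows n)"
  unfolding rows_def by (intro finite_cartesian_product finite_bracketing finite_PiE) auto

end

theory Submission
  imports Defs
begin

text \<open>A false row \<open>\<psi> \<rightarrow> \<phi>\<close> has \<open>\<psi>\<close> true and \<open>\<phi>\<close> false, and rows counted by \<open>t2\<close> have it the
  other way round. Writing \<open>T\<close> for the generating function of all true rows, both are therefore
  counted by \<open>F T\<close>, up to the single false row of the formula \<open>p\<^sub>1\<close>; this gives
  \<open>F - x = T F = T\<^sub>2\<close>. Likewise \<open>T = x + F\<^sup>2 + F T + T\<^sup>2\<close>. Eliminating, \<open>1 - 2 (F + T)\<close> squares
  to \<open>1 - 8 x\<close> and \<open>2 + 2 (F - T)\<close> squares to \<open>2 + 2 \<surd>(1 - 8 x) + 8 x\<close>.\<close>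

text \<open>Intervals other than \<open>{1..n}\<close> are needed because the right side of a split
  starts at \<open>Suc k\<close>.\<close>

definition val_rows :: "bool \<Rightarrow> nat \<Rightarrow> nat \<Rightarrow> (form \<times> (nat \<Rightarrow> bool)) set" where
  "val_rows b i j = {(\<phi>, v). bracketing i j \<phi> \<and> v \<in> {i..j} \<rightarrow>\<^sub>E UNIV \<and> eval v \<phi> = b}"

definition imp_rows :: "bool \<Rightarrow> bool \<Rightarrow> nat \<Rightarrow> nat \<Rightarrow> (form \<times> (nat \<Rightarrow> bool)) set" where
  "imp_rows a b i j = {(\<chi>, v). bracketing i j \<chi> \<and> v \<in> {i..j} \<rightarrow>\<^sub>E UNIV \<and>
     (\<exists>\<psi> \<phi>. \<chi> = Imp \<psi> \<phi> \<and> eval v \<psi> = a \<and> eval v \<phi> = b)}"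

lemma finite_interval_rows:
  "finite ({\<phi>. bracketing i j \<phi>} \<times> ({i..j} \<rightarrow>\<^sub>E (UNIV :: bool set)))"
  by (intro finite_cartesian_product finite_bracketing finite_PiE) auto

lemma finite_val_rows: "finite (val_rows b i j)"
  by (rule finite_subset[OF _ finite_interval_rows[of i j]]) (auto simp: val_rows_def)

lemma finite_imp_rows: "finite (imp_rows a b i j)"
  by (rule finite_subset[OF _ finite_interval_rows[of i j]]) (auto simp: imp_rows_def)

lemma bracketing_Var_iff: "bracketing i j (Var m) \<longleftrightarrow> i = m \<and> j = m"
  by (auto intro: bracketing.single elim: bracketing.cases)

lemma bracketing_Imp_iff:
  "bracketing i j (Imp \<psi> \<phi>) \<longleftrightarrow> (\<exists>k. bracketing i k \<psi> \<and> bracketing (Suc k) j \<phi>)"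
  by (auto intro: bracketing.split elim: bracketing.cases)

text \<open>The leftmost and rightmost variables of a formula are the ends of its interval. Hence an
  implication determines its split point.\<close>

lemma bracketing_unique:
  "bracketing i j \<phi> \<Longrightarrow> bracketing i' j' \<phi> \<Longrightarrow> i = i' \<and> j = j'"
  by (induction \<phi> arbitrary: i j i' j') (fastforce simp: bracketing_Var_iff bracketing_Imp_iff)+

lemma bracketing_refl: "bracketing i i \<phi> \<longleftrightarrow> \<phi> = Var i"
  by (cases \<phi>) (auto simp: bracketing_Var_iff bracketing_Imp_iff dest!: bracketing_le)

lemma eval_cong:
  "bracketing i j \<phi> \<Longrightarrow> (\<And>x. i \<le> x \<Longrightarrow> x \<le> j \<Longrightarrow> v x = w x) \<Longrightarrow> eval v \<phi> = eval w \<phi>"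
proof (induction rule: bracketing.induct)
  case (split i k \<psi> j \<phi>)
  have "i \<le> k" "Suc k \<le> j" using split.hyps by (auto dest: bracketing_le)
  then show ?case using split.IH split.prems by simp
qed simp

text \<open>The two sides share no variables, so for a fixed split point a row is an independent
  choice of a row on \<open>{i..k}\<close> and one on \<open>{Suc k..j}\<close>. The proof makes
  this a bijection from a disjoint union of products.\<close>

lemma card_imp_rows:
  "card (imp_rows a b i j) = (\<Sum>k=i..<j. card (val_rows a i k) * card (val_rows b (Suc k) j))"
proof -
  let ?S = "SIGMA k:{i..<j}. val_rows a i k \<times> val_rows b (Suc k) j"
  \<comment> \<open>Below \<open>i\<close> and above \<open>j\<close> the glued valuation inherits
    \<open>undefined\<close> from \<open>v\<close> and \<open>w\<close>, so it is again
    extensional.\<close>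
  let ?merge = "\<lambda>(k, (\<psi>, v), (\<phi>, w)). (Imp \<psi> \<phi>, \<lambda>x. if x \<le> k then v x else w x)"
  have inj: "inj_on ?merge ?S"
  proof (rule inj_onI, clarsimp simp: val_rows_def)
    fix k k' \<psi> \<phi> and v w v' w' :: "nat \<Rightarrow> bool"
    assume br: "bracketing i k \<psi>" "bracketing i k' \<psi>"
      and eq: "(\<lambda>x. if x \<le> k then v x else w x) = (\<lambda>x. if x \<le> k' then v' x else w' x)"
      and v: "v \<in> {i..k} \<rightarrow>\<^sub>E UNIV" "v' \<in> {i..k'} \<rightarrow>\<^sub>E UNIV"
      and w: "w \<in> {Suc k..j} \<rightarrow>\<^sub>E UNIV" "w' \<in> {Suc k'..j} \<rightarrow>\<^sub>E UNIV"
    have k: "k' = k" using bracketing_unique[OF br] by simp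
    have x: "(if x \<le> k then v x else w x) = (if x \<le> k then v' x else w' x)" for x
      using fun_cong[OF eq, of x] by (simp add: k)
    have "v = v'"
    proof (rule PiE_ext[OF v(1) v(2)[unfolded k]])
      fix y assume "y \<in> {i..k}"
      then show "v y = v' y" using x[of y] by simp
    qed
    moreover have "w = w'"
    proof (rule PiE_ext[OF w(1) w(2)[unfolded k]])
      fix y assume "y \<in> {Suc k..j}"
      then show "w y = w' y" using x[of y] by simp
    qed
    ultimately show "k = k' \<and> v = v' \<and> w = w'" using k by simp
  qed
  have "?merge ` ?S = imp_rows a b i j"
  proof (intro equalityI subsetI)
    fix r assume "r \<in> ?merge ` ?S"
    then obtain k \<psi> v \<phi> w where r: "r = (Imp \<psi> \<phi>, \<lambda>x. if x \<le> k then v x else w x)"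
      and k: "i \<le> k" "k < j"
      and \<psi>: "bracketing i k \<psi>" "v \<in> {i..k} \<rightarrow>\<^sub>E UNIV" "eval v \<psi> = a"
      and \<phi>: "bracketing (Suc k) j \<phi>" "w \<in> {Suc k..j} \<rightarrow>\<^sub>E UNIV" "eval w \<phi> = b"
      by (auto simp: val_rows_def)
    let ?u = "\<lambda>x. if x \<le> k then v x else w x"
    have "eval ?u \<psi> = a" using eval_cong[OF \<psi>(1), of ?u v] \<psi>(3) by simp
    moreover have "eval ?u \<phi> = b" using eval_cong[OF \<phi>(1), of ?u w] \<phi>(3) by simp
    moreover have "?u \<in> {i..j} \<rightarrow>\<^sub>E UNIV"
      using \<psi>(2) \<phi>(2) k by (auto simp: PiE_def extensional_def)
    ultimately show "r \<in> imp_rows a b i j"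
      using \<psi>(1) \<phi>(1) by (auto simp: r imp_rows_def bracketing_Imp_iff)
  next
    fix r assume "r \<in> imp_rows a b i j"
    then obtain \<psi> \<phi> u k where r: "r = (Imp \<psi> \<phi>, u)" and u: "u \<in> {i..j} \<rightarrow>\<^sub>E UNIV"
      and ev: "eval u \<psi> = a" "eval u \<phi> = b"
      and br: "bracketing i k \<psi>" "bracketing (Suc k) j \<phi>"
      by (auto simp: imp_rows_def bracketing_Imp_iff)
    have k: "i \<le> k" "Suc k \<le> j" using br by (auto dest: bracketing_le)
    \<comment> \<open>Restricting to the two subintervals inverts \<open>?merge\<close>.\<close>
    let ?v = "restrict u {i..k}" and ?w = "restrict u {Suc k..j}"
    have "eval ?v \<psi> = a" using eval_cong[OF br(1), of ?v u] ev by simp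
    moreover have "eval ?w \<phi> = b" using eval_cong[OF br(2), of ?w u] ev by simp
    ultimately have "(k, (\<psi>, ?v), (\<phi>, ?w)) \<in> ?S"
      using br k by (auto simp: val_rows_def)
    moreover have "r = ?merge (k, (\<psi>, ?v), (\<phi>, ?w))"
      using u by (auto simp: r fun_eq_iff PiE_def extensional_def)
    ultimately show "r \<in> ?merge ` ?S" by (rule rev_image_eqI)
  qed
  then have "card (imp_rows a b i j) = card ?S"
    using card_image[OF inj] by simp
  also have "\<dots> = (\<Sum>k=i..<j. card (val_rows a i k) * card (val_rows b (Suc k) j))"
    by (simp add: finite_val_rows card_cartesian_product)
  finally show ?thesis .
qed

text \<open>This single row, for either truth value, is the source of the \<open>fps_X\<close> terms
  below.\<close>

lemma card_val_rows_refl: "card (val_rows b i i) = 1"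
proof -
  have "val_rows b i i = {(Var i, \<lambda>x. if x = i then b else undefined)}"
    by (auto simp: val_rows_def bracketing_refl PiE_def extensional_def fun_eq_iff)
  then show ?thesis by simp
qed

lemma val_rows_imp_rows:
  assumes "i < j"
  shows "val_rows b i j = (\<Union>(c, d)\<in>{(c, d). (c \<longrightarrow> d) = b}. imp_rows c d i j)"
proof -
  have "(\<phi>, v) \<in> val_rows b i j \<longleftrightarrow>
      (\<phi>, v) \<in> (\<Union>(c, d)\<in>{(c, d). (c \<longrightarrow> d) = b}. imp_rows c d i j)" for \<phi> v
    using assms by (cases \<phi>) (auto simp: val_rows_def imp_rows_def bracketing_Var_iff)
  then show ?thesis by auto
qed

lemma val_rows_False:
  assumes "i < j"
  shows "val_rows False i j = imp_rows True False i j"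
proof -
  have "{(c, d). (c \<longrightarrow> d) = False} = {(True, False)}" by auto
  then show ?thesis unfolding val_rows_imp_rows[OF assms] by simp
qed

lemma card_val_rows_True:
  assumes "i < j"
  shows "card (val_rows True i j) =
    card (imp_rows False False i j) + card (imp_rows False True i j) + card (imp_rows True True i j)"
proof -
  have "val_rows True i j =
      (imp_rows False False i j \<union> imp_rows False True i j) \<union> imp_rows True True i j"
  proof -
    have "{(c, d). (c \<longrightarrow> d) = True} = {(False, False), (False, True), (True, True)}" by auto
    then show ?thesis unfolding val_rows_imp_rows[OF assms] by auto
  qed
  moreover have "imp_rows False False i j \<inter> imp_rows False True i j = {}"
    and "(imp_rows False False i j \<union> imp_rows False True i j) \<inter> imp_rows True True i j = {}"
    by (auto simp: imp_rows_def)
  ultimately show ?thesis by (simp add: card_Un_disjoint finite_imp_rows)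
qed

lemma val_rows_empty: "j < i \<Longrightarrow> val_rows b i j = {}"
  by (auto simp: val_rows_def dest: bracketing_le)

text \<open>Instead of renaming variables, the proof uses that the recursion through
  \<open>card_imp_rows\<close> is translation invariant; both sides of a split are shorter, so
  induction on the length applies.\<close>

lemma card_val_rows_shift: "card (val_rows b (i + d) (j + d)) = card (val_rows b i j)"
proof (induction "j - i" arbitrary: b i j rule: less_induct)
  case less
  consider "j < i" | "i = j" | "i < j" by linarith
  then show ?case
  proof cases
    case 3
    have imp: "card (imp_rows a c (i + d) (j + d)) = card (imp_rows a c i j)" for a c
    proof -
      have "card (imp_rows a c (i + d) (j + d)) =
          (\<Sum>k=i..<j. card (val_rows a (i + d) (k + d)) * card (val_rows c (Suc k + d) (j + d)))"
        by (simp add: card_imp_rows sum.shift_bounds_nat_ivl)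
      also have "\<dots> = (\<Sum>k=i..<j. card (val_rows a i k) * card (val_rows c (Suc k) j))"
        by (intro sum.cong refl arg_cong2[where f = "(*)"] less) auto
      finally show ?thesis by (simp add: card_imp_rows)
    qed
    show ?thesis
      using 3 by (cases b) (simp_all add: val_rows_False card_val_rows_True imp)
  qed (simp_all add: val_rows_empty card_val_rows_refl)
qed

definition val_fps :: "bool \<Rightarrow> real fps" where
  "val_fps b = Abs_fps (\<lambda>n. if n = 0 then 0 else real (card (val_rows b 1 n)))"

lemma val_fps_nth: "fps_nth (val_fps b) n = (if n = 0 then 0 else real (card (val_rows b 1 n)))"
  by (simp add: val_fps_def)

text \<open>The Cauchy product sums over the split point \<open>k\<close>; a shift by
  \<open>k\<close> turns rows on \<open>{1..n - k}\<close> into rows on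
  \<open>{Suc k..n}\<close>.\<close>

lemma val_fps_mult_nth:
  "fps_nth (val_fps a * val_fps b) n = real (card (imp_rows a b 1 n))"
proof (cases n)
  case 0
  then show ?thesis by (simp add: val_fps_nth card_imp_rows)
next
  case (Suc m)
  have "fps_nth (val_fps a * val_fps b) n =
      (\<Sum>k=0..n. fps_nth (val_fps a) k * fps_nth (val_fps b) (n - k))"
    by (simp add: fps_mult_nth)
  \<comment> \<open>The terms \<open>k = 0\<close> and \<open>k = n\<close> vanish, since both
    series have constant term 0.\<close>
  also have "\<dots> = (\<Sum>k=1..<n. fps_nth (val_fps a) k * fps_nth (val_fps b) (n - k))"
    by (rule sum.mono_neutral_right) (auto simp: val_fps_nth)
  also have "\<dots> = (\<Sum>k=1..<n. real (card (val_rows a 1 k) * card (val_rows b (Suc k) n)))"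
  proof (rule sum.cong[OF refl])
    fix k assume "k \<in> {1..<n}"
    then show "fps_nth (val_fps a) k * fps_nth (val_fps b) (n - k) =
        real (card (val_rows a 1 k) * card (val_rows b (Suc k) n))"
      using card_val_rows_shift[of b 1 k "n - k"] by (simp add: val_fps_nth)
  qed
  finally show ?thesis by (simp add: card_imp_rows)
qed

lemma val_fps_False: "val_fps False = fps_X + val_fps True * val_fps False"
proof (rule fps_ext)
  fix n :: nat
  consider "n = 0" | "n = 1" | "1 < n" by linarith
  then show "fps_nth (val_fps False) n = fps_nth (fps_X + val_fps True * val_fps False) n"
    by cases (simp_all add: val_fps_nth val_fps_mult_nth val_rows_False card_imp_rows
        card_val_rows_refl[unfolded One_nat_def])
qed

text \<open>The three products are the three pairs of truth values that make an implication
  true.\<close>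

lemma val_fps_True:
  "val_fps True = fps_X + val_fps False * val_fps False + val_fps False * val_fps True
     + val_fps True * val_fps True"
proof (rule fps_ext)
  fix n :: nat
  consider "n = 0" | "n = 1" | "1 < n" by linarith
  then show "fps_nth (val_fps True) n = fps_nth (fps_X + val_fps False * val_fps False
      + val_fps False * val_fps True + val_fps True * val_fps True) n"
  proof cases
    case 3
    then show ?thesis by (simp add: val_fps_nth val_fps_mult_nth card_val_rows_True)
  qed (simp_all add: val_fps_nth val_fps_mult_nth card_imp_rows
      card_val_rows_refl[unfolded One_nat_def])
qed

lemma F_eq: "F = val_fps False"
proof -
  have "f n = card (val_rows False 1 n)" for n
    unfolding f_def rows_def val_rows_def by (rule arg_cong[where f = card]) auto
  then show ?thesis by (simp only: F_def val_fps_def)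
qed

lemma T2_eq: "T2 = val_fps False * val_fps True"
proof (rule fps_ext)
  fix n
  have "t2 n = card (imp_rows False True 1 n)"
  proof (cases "n < 2")
    case True
    \<comment> \<open>There is no split point for \<open>n < 2\<close>, which agrees with the value
      0 set in \<open>t2\<close>.\<close>
    then show ?thesis by (simp add: t2_def card_imp_rows)
  next
    case False
    then show ?thesis
      unfolding t2_def rows_def imp_rows_def by (auto intro!: arg_cong[where f = card])
  qed
  then show "fps_nth T2 n = fps_nth (val_fps False * val_fps True) n"
    by (simp add: T2_def val_fps_mult_nth)
qed

theorem proposition4p6:
  shows "T2 = F - fps_X \<and>
    F - fps_X =
      (- 1 - fps_sqrt (1 - 8 * fps_X)
        + fps_sqrt (2 + 2 * fps_sqrt (1 - 8 * fps_X) + 8 * fps_X) - 4 * fps_X) / 4"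
proof
  define T where "T = val_fps True"
  have F: "F = fps_X + T * F" and T: "T = fps_X + F * F + F * T + T * T"
    using val_fps_False val_fps_True by (simp_all add: F_eq T_def)
  have F0: "fps_nth F 0 = 0" and T0: "fps_nth T 0 = 0"
    by (simp_all add: F_def T_def val_fps_def)
  \<comment> \<open>Replacing \<open>fps_X\<close> by this leaves identities between polynomials in
    \<open>F\<close> and \<open>T\<close>, which hold modulo the single relation
    \<open>sq\<close>.\<close>
  have X: "fps_X = F - T * F" using F by (simp add: algebra_simps)
  show "T2 = F - fps_X"
    by (simp add: X) (simp add: T2_eq F_eq T_def mult.commute)
  have sq: "F * F + T * T = T - F" using T unfolding X by (simp add: algebra_simps)
  have "(1 - 2 * (F + T)) ^ 2 = 1 - 8 * fps_X"
    using sq unfolding X by algebra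
  \<comment> \<open>\<open>F\<close> and \<open>T\<close> have constant term 0, so this root has
    constant term 1 and the one in \<open>r\<close> has 2; positivity fixes both signs.\<close>
  then have s: "fps_sqrt (1 - 8 * fps_X) = 1 - 2 * (F + T)"
    by (intro fps_sqrt_iff[THEN iffD2, symmetric]) (simp_all add: F0 T0)
  have "(2 + 2 * (F - T)) ^ 2 = 2 + 2 * fps_sqrt (1 - 8 * fps_X) + 8 * fps_X"
    using sq unfolding s unfolding X by algebra
  then have r: "fps_sqrt (2 + 2 * fps_sqrt (1 - 8 * fps_X) + 8 * fps_X) = 2 + 2 * (F - T)"
    by (intro fps_sqrt_iff[THEN iffD2, symmetric]) (simp_all add: F0 T0 s)
  have "- 1 - fps_sqrt (1 - 8 * fps_X)
      + fps_sqrt (2 + 2 * fps_sqrt (1 - 8 * fps_X) + 8 * fps_X) - 4 * fps_X = 4 * (F - fps_X)"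
    \<comment> \<open>\<open>T\<close> enters the two roots with equal coefficients -2, so it
      cancels in their difference.\<close>
    unfolding r unfolding s by (simp add: algebra_simps)
  then have "(- 1 - fps_sqrt (1 - 8 * fps_X)
      + fps_sqrt (2 + 2 * fps_sqrt (1 - 8 * fps_X) + 8 * fps_X) - 4 * fps_X) / 4
    = 4 * (F - fps_X) / 4"
    by (rule arg_cong)
  also have "\<dots> = F - fps_X" by (rule nonzero_mult_div_cancel_left) simp
  finally show "F - fps_X = (- 1 - fps_sqrt (1 - 8 * fps_X)
      + fps_sqrt (2 + 2 * fps_sqrt (1 - 8 * fps_X) + 8 * fps_X) - 4 * fps_X) / 4" ..
qed

end
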